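(* There exists a frequently hypercyclic bounded linear operator $T$ on the Banach space $c_0(\mathbb Z)$ which does not admit any ergodic Borel probability measure with full support.
   Context: $T$ is frequently hypercyclic if there is $x$ such that for every nonempty open $V$, $\liminf_{N\to\infty}\frac1N\#\{n\in[1,N]:T^nx\in V\}>0$. A $T$-invariant Borel probability measure $m$ is ergodic if every Borel set $A$ with $T^{-1}(A)=A$ satisfies $m(A)\in\{0,1\}$; it has full support if $m(U)>0$ for every nonempty open $U$. *)

theory Defs
  imports "HOL-Probability.Probability"
begin

text \<open>c_0(Z): real sequences indexed by the integers tending to 0 as |n| tends to infinity
  (i.e. along the cofinite filter on int), with the sup norm. Realised as a subspace of the
  bounded continuous functions int => real (int carries the discrete topology).\<close>

definition c0_set :: "(int \<Rightarrow>\<^sub>C real) set" where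
  "c0_set = {f. ((\<lambda>n. apply_bcontfun f n) \<longlongrightarrow> 0) cofinite}"

typedef c0 = c0_set
  morphisms c0_rep Abs_c0
  by (rule exI[of _ 0]) (simp add: c0_set_def)

setup_lifting type_definition_c0

instantiation c0 :: real_normed_vector
begin

lift_definition zero_c0 :: c0 is 0 by (simp add: c0_set_def)
lift_definition plus_c0 :: "c0 \<Rightarrow> c0 \<Rightarrow> c0" is "(+)"
  by (auto simp: c0_set_def intro: tendsto_add_zero)
lift_definition minus_c0 :: "c0 \<Rightarrow> c0 \<Rightarrow> c0" is "(-)"
  by (auto simp: c0_set_def dest: tendsto_diff[where b=0, simplified])
lift_definition uminus_c0 :: "c0 \<Rightarrow> c0" is uminus
  using tendsto_minus[where a="0::real"] by (auto simp: c0_set_def)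
lift_definition scaleR_c0 :: "real \<Rightarrow> c0 \<Rightarrow> c0" is scaleR
  using tendsto_mult_right_zero by (auto simp: c0_set_def)
lift_definition norm_c0 :: "c0 \<Rightarrow> real" is norm .
lift_definition dist_c0 :: "c0 \<Rightarrow> c0 \<Rightarrow> real" is dist .
lift_definition sgn_c0 :: "c0 \<Rightarrow> c0" is "\<lambda>f. f /\<^sub>R norm f"
  using tendsto_mult_right_zero by (auto simp: c0_set_def)
definition uniformity_c0 :: "(c0 \<times> c0) filter" where
  "uniformity_c0 = (INF e\<in>{0<..}. principal {(x, y). dist x y < e})"
definition open_c0 :: "c0 set \<Rightarrow> bool" where
  "open_c0 U = (\<forall>x\<in>U. \<forall>\<^sub>F (x', y) in uniformity. x' = x \<longrightarrow> y \<in> U)"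

instance
proof
  fix x y z :: c0 and a b :: real and U :: "c0 set"
  show "x + y + z = x + (y + z)" by transfer (simp add: add.assoc)
  show "x + y = y + x" by transfer (simp add: add.commute)
  show "0 + x = x" by transfer simp
  show "- x + x = 0" by transfer simp
  show "x - y = x + - y" by transfer simp
  show "a *\<^sub>R (x + y) = a *\<^sub>R x + a *\<^sub>R y" by transfer (simp add: scaleR_add_right)
  show "(a + b) *\<^sub>R x = a *\<^sub>R x + b *\<^sub>R x" by transfer (simp add: scaleR_add_left)
  show "a *\<^sub>R b *\<^sub>R x = (a * b) *\<^sub>R x" by transfer simp
  show "1 *\<^sub>R x = x" by transfer simp
  show "dist x y = norm (x - y)" by transfer (simp add: dist_norm)
  show "sgn x = inverse (norm x) *\<^sub>R x" by transfer (simp add: divide_inverse_commute)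
  show "(norm x = 0) = (x = 0)" by transfer simp
  show "norm (x + y) \<le> norm x + norm y" by transfer (rule norm_triangle_ineq)
  show "norm (a *\<^sub>R x) = \<bar>a\<bar> * norm x" by transfer simp
  show "(uniformity :: (c0 \<times> c0) filter) = (INF e\<in>{0<..}. principal {(x, y). dist x y < e})"
    by (simp add: uniformity_c0_def)
  show "open U = (\<forall>x\<in>U. \<forall>\<^sub>F (x', y) in uniformity. x' = x \<longrightarrow> y \<in> U)"
    by (simp add: open_c0_def)
qed

end

definition freq_hypercyclic :: "('a::topological_space \<Rightarrow> 'a) \<Rightarrow> bool" where
  "freq_hypercyclic T \<longleftrightarrow>
     (\<exists>x. \<forall>V. open V \<and> V \<noteq> {} \<longrightarrow>
        liminf (\<lambda>N::nat. ereal (real (card {n \<in> {1..N}. (T ^^ n) x \<in> V}) / real N)) > 0)"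

definition borel_prob_measure :: "'a::topological_space measure \<Rightarrow> bool" where
  "borel_prob_measure m \<longleftrightarrow> sets m = sets borel \<and> prob_space m"

definition invariant_measure :: "('a::topological_space \<Rightarrow> 'a) \<Rightarrow> 'a measure \<Rightarrow> bool" where
  "invariant_measure T m \<longleftrightarrow> (\<forall>A \<in> sets borel. emeasure m (T -` A) = emeasure m A)"

definition ergodic_measure :: "('a::topological_space \<Rightarrow> 'a) \<Rightarrow> 'a measure \<Rightarrow> bool" where
  "ergodic_measure T m \<longleftrightarrow>
     (\<forall>A \<in> sets borel. T -` A = A \<longrightarrow> emeasure m A = 0 \<or> emeasure m A = 1)"

definition full_support :: "'a::topological_space measure \<Rightarrow> bool" where
  "full_support m \<longleftrightarrow> (\<forall>U. open U \<and> U \<noteq> {} \<longrightarrow> emeasure m U > 0)"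

end

theory Submission
  imports Defs
begin

text \<open>
  \<open>T\<close> is the weighted backward shift \<open>(Tx)\<^sub>j = (W (j+1) / W j) x\<^sub>j\<^sub>+\<^sub>1\<close> with \<open>W = 2 ^ elevation\<close>.

  Suppose \<open>W\<close> is bounded on a set \<open>D\<close> of natural numbers of positive upper density. If \<open>\<parallel>x\<parallel> \<le> R\<close> and
  \<open>d \<in> D\<close>, then the coordinate of \<open>T ^ d x\<close> at \<open>0\<close> is bounded by a multiple of \<open>R\<close>: orbits starting in
  the ball of radius \<open>R\<close> avoid some nonempty open set \<open>A\<close> at all times in \<open>D\<close>. For an ergodic measure
  \<open>m\<close> the visits to \<open>A\<close> of almost every orbit have frequency \<open>m A\<close>, and those at times in \<open>D\<close> come only
  from starting points outside the ball. Averaging over \<open>x\<close>, the upper density of \<open>D\<close> is at most the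
  measure of the complement of the ball whenever \<open>m A > 0\<close>, which is absurd for large \<open>R\<close>.

  For frequent hypercyclicity, a pattern with index \<open>p\<close> is planted around each point of a set
  \<open>E\<^sub>p\<close> of positive lower density, and \<open>W\<close> has to be large near \<open>E\<^sub>q - E\<^sub>p\<close>. Here \<open>E\<^sub>p\<close> consists
  of the multiples of a sparse period in the blocks \<open>[10 ^ u, 2 * 10 ^ u)\<close> for which the 2-adic
  valuation of \<open>u\<close> is \<open>p\<close>. Differences between distinct blocks \<open>u > v\<close> lie close to the block \<open>u\<close>, and
  differences inside one block are multiples of the period, so \<open>W\<close> can stay equal to \<open>1\<close> on most of
  \<open>(3 * 10 ^ u, 5 * 10 ^ u)\<close>. Negative differences are harmless since \<open>W (-n) = 2 ^ n\<close>.
\<close>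

section \<open>Densities of sets of natural numbers\<close>

definition lower_density :: "nat set \<Rightarrow> ereal" where
  "lower_density D = liminf (\<lambda>N. ereal (real (card (D \<inter> {1..N})) / real N))"

definition upper_density :: "nat set \<Rightarrow> ereal" where
  "upper_density D = limsup (\<lambda>N. ereal (real (card (D \<inter> {1..N})) / real N))"

lemma lower_density_mono:
  assumes "D \<subseteq> D'"
  shows "lower_density D \<le> lower_density D'"
  unfolding lower_density_def
proof (intro Liminf_mono always_eventually allI)
  fix N
  have "card (D \<inter> {1..N}) \<le> card (D' \<inter> {1..N})" using assms by (intro card_mono) auto
  then show "ereal (real (card (D \<inter> {1..N})) / real N) \<le> ereal (real (card (D' \<inter> {1..N})) / real N)"
    by (simp add: divide_right_mono)
qed

lemma lower_density_pos_if_dense_at_geometric_scales: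
  assumes b: "strict_mono b" "0 < b 0" and growth: "\<And>j. b (Suc j) \<le> R * b j"
    and "0 < c" and dense: "\<And>j. c * real (b j) \<le> real (card (D \<inter> {1..b j}))"
  shows "0 < lower_density D"
proof -
  have "0 < R" using growth[of 0] strict_monoD[OF b(1), of 0 "Suc 0"] by (cases R) auto
  have "c / R \<le> real (card (D \<inter> {1..N})) / real N" if N: "b 0 \<le> N" for N
  proof -
    have "N < b (Suc N)" using seq_suble[OF b(1), of "Suc N"] by linarith
    then obtain j where j: "b j \<le> N" "N < b (Suc j)"
      using ex_least_nat_less[of "\<lambda>i. N < b i" "Suc N"] N by (auto simp: not_less)
    have "real N \<le> real R * real (b j)"
      using j growth[of j] by (simp flip: of_nat_mult)
    then have "c / R * real N \<le> c * real (b j)" using \<open>0 < R\<close> \<open>0 < c\<close> by (simp add: field_simps)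
    also have "\<dots> \<le> real (card (D \<inter> {1..b j}))" by (rule dense)
    also have "\<dots> \<le> real (card (D \<inter> {1..N}))" using j by (auto intro!: card_mono)
    finally show ?thesis using N b(2) by (simp add: pos_le_divide_eq)
  qed
  then have "ereal (c / R) \<le> lower_density D"
    unfolding lower_density_def by (intro Liminf_bounded) (auto simp: eventually_sequentially)
  moreover have "0 < ereal (c / R)" using \<open>0 < R\<close> \<open>0 < c\<close> by simp
  ultimately show ?thesis by (rule less_le_trans[rotated])
qed

lemma upper_density_ge_if_dense_at_scales:
  fixes b :: "nat \<Rightarrow> nat"
  assumes b: "strict_mono b" "0 < b 0"
    and dense: "\<And>j. c * real (b j) \<le> real (card (D \<inter> {1..b j}))"
  shows "ereal c \<le> upper_density D"
proof -
  have "0 < b j" for j using b(2) strict_mono_leD[OF b(1), of 0 j] by (simp add: less_le_trans)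
  then have "c \<le> real (card (D \<inter> {1..b j})) / real (b j)" for j
    using dense[of j] by (simp add: pos_le_divide_eq)
  then have "ereal c \<le> limsup ((\<lambda>N. ereal (real (card (D \<inter> {1..N})) / real N)) \<circ> b)"
    by (intro le_Limsup) auto
  also have "\<dots> \<le> upper_density D"
    unfolding upper_density_def by (rule limsup_subseq_mono[OF b(1)])
  finally show ?thesis .
qed

lemma freq_hypercyclicI:
  assumes "\<And>V. open V \<Longrightarrow> V \<noteq> {} \<Longrightarrow> 0 < lower_density {n. (T ^^ n) x \<in> V}"
  shows "freq_hypercyclic T"
proof -
  have "{n \<in> {1..N}. (T ^^ n) x \<in> V} = {n. (T ^^ n) x \<in> V} \<inter> {1..N}" for V N by auto
  then have "\<forall>V. open V \<and> V \<noteq> {} \<longrightarrow>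
      liminf (\<lambda>N. ereal (real (card {n \<in> {1..N}. (T ^^ n) x \<in> V}) / real N)) > 0"
    using assms by (simp only: lower_density_def) blast
  then show ?thesis unfolding freq_hypercyclic_def by blast
qed

section \<open>The ergodic theorem\<close>

definition birkhoff_sum :: "('a \<Rightarrow> 'a) \<Rightarrow> ('a \<Rightarrow> real) \<Rightarrow> nat \<Rightarrow> 'a \<Rightarrow> real" where
  "birkhoff_sum T g n x = (\<Sum>k<n. g ((T ^^ k) x))"

lemma birkhoff_sum_0 [simp]: "birkhoff_sum T g 0 x = 0"
  by (simp add: birkhoff_sum_def)

lemma birkhoff_sum_Suc: "birkhoff_sum T g (Suc n) x = g x + birkhoff_sum T g n (T x)"
  by (simp add: birkhoff_sum_def sum.lessThan_Suc_shift funpow_Suc_right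
      del: sum.lessThan_Suc funpow.simps)

lemma birkhoff_sum_diff_const: "birkhoff_sum T (\<lambda>x. g x - t) n x = birkhoff_sum T g n x - real n * t"
  by (simp add: birkhoff_sum_def sum_subtractf)

lemma birkhoff_sum_uminus: "birkhoff_sum T (\<lambda>x. - g x) n x = - birkhoff_sum T g n x"
  by (simp add: birkhoff_sum_def sum_negf)

lemma birkhoff_sum_indicator_bounds:
  "0 \<le> birkhoff_sum T (indicator A) n x" "birkhoff_sum T (indicator A) n x \<le> real n"
proof -
  show "0 \<le> birkhoff_sum T (indicator A) n x" unfolding birkhoff_sum_def by (rule sum_nonneg) simp
  have "birkhoff_sum T (indicator A) n x \<le> (\<Sum>k<n. 1)"
    unfolding birkhoff_sum_def by (rule sum_mono) (simp add: indicator_def)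
  then show "birkhoff_sum T (indicator A) n x \<le> real n" by simp
qed

lemma limsup_birkhoff_average_invariant:
  "limsup (\<lambda>n. ereal (birkhoff_sum T g n (T x) / real n))
    = limsup (\<lambda>n. ereal (birkhoff_sum T g n x / real n))"
proof -
  let ?a = "\<lambda>x n. ereal (birkhoff_sum T g n x / real n)"
  have step: "?a x (n + 1) = ereal (g x / real (Suc n)) + ereal (real n / real (Suc n)) * ?a (T x) n" for n
    by (simp add: birkhoff_sum_Suc add_divide_distrib)
  have first_term: "(\<lambda>n. ereal (g x / real (Suc n))) \<longlonglongrightarrow> 0"
    using LIMSEQ_Suc[OF lim_const_over_n[of "g x"]] by (simp add: zero_ereal_def)
  have ratio: "(\<lambda>n. ereal (real n / real (Suc n))) \<longlonglongrightarrow> 1"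
    using LIMSEQ_n_over_Suc_n by (simp add: one_ereal_def)
  have "limsup (?a x) = limsup (\<lambda>n. ?a x (n + 1))"
    by (rule limsup_shift[symmetric])
  also have "\<dots> = limsup (\<lambda>n. ereal (g x / real (Suc n)) + ereal (real n / real (Suc n)) * ?a (T x) n)"
    by (simp only: step)
  also have "\<dots> = 0 + limsup (\<lambda>n. ereal (real n / real (Suc n)) * ?a (T x) n)"
    by (rule ereal_limsup_lim_add[OF first_term]) simp
  also have "\<dots> = 0 + 1 * limsup (?a (T x))"
    by (subst ereal_limsup_lim_mult[OF ratio]) simp_all
  finally show ?thesis by simp
qed

primrec max_partial_sum :: "('a \<Rightarrow> 'a) \<Rightarrow> ('a \<Rightarrow> real) \<Rightarrow> nat \<Rightarrow> 'a \<Rightarrow> real" where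
  "max_partial_sum T g 0 x = 0"
| "max_partial_sum T g (Suc n) x = max 0 (g x + max_partial_sum T g n (T x))"

lemma max_partial_sum_nonneg: "0 \<le> max_partial_sum T g n x"
  by (cases n) auto

lemma max_partial_sum_mono:
  assumes "m \<le> n"
  shows "max_partial_sum T g m x \<le> max_partial_sum T g n x"
  using assms
proof (induction m arbitrary: n x)
  case 0
  show ?case by (simp add: max_partial_sum_nonneg)
next
  case (Suc m)
  then obtain n' where "n = Suc n'" "m \<le> n'" by (cases n) auto
  then show ?case using Suc.IH[of n' "T x"] by auto
qed

lemma birkhoff_sum_le_max_partial_sum: "birkhoff_sum T g n x \<le> max_partial_sum T g n x"
proof (induction n arbitrary: x)
  case (Suc n)
  show ?case using Suc[of "T x"] by (simp add: birkhoff_sum_Suc)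
qed simp

locale measure_preserving = prob_space +
  fixes T :: "'a \<Rightarrow> 'a"
  assumes measurable_T [measurable]: "T \<in> measurable M M"
    and distr_T: "distr M M T = M"
begin

lemma measurable_funpow [measurable]: "T ^^ n \<in> measurable M M"
  by (induction n) (auto intro: measurable_comp)

lemma measurable_birkhoff_sum [measurable]:
  assumes [measurable]: "g \<in> borel_measurable M"
  shows "birkhoff_sum T g n \<in> borel_measurable M"
  unfolding birkhoff_sum_def by measurable

lemma AE_comp:
  assumes "AE x in M. P x"
  shows "AE x in M. P (T x)"
  by (rule AE_distrD[OF measurable_T]) (use assms in \<open>simp only: distr_T\<close>)

lemma integrable_comp:
  fixes f :: "'a \<Rightarrow> real"
  assumes "integrable M f"
  shows "integrable M (\<lambda>x. f (T x))"
  using assms integrable_distr[OF measurable_T, of f] by (simp add: distr_T)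

lemma integral_comp:
  fixes f :: "'a \<Rightarrow> real"
  assumes "f \<in> borel_measurable M"
  shows "(\<integral>x. f (T x) \<partial>M) = (\<integral>x. f x \<partial>M)"
  using integral_distr[OF measurable_T assms] by (simp add: distr_T)

lemma integral_comp_funpow:
  fixes f :: "'a \<Rightarrow> real"
  assumes [measurable]: "f \<in> borel_measurable M"
  shows "(\<integral>x. f ((T ^^ n) x) \<partial>M) = (\<integral>x. f x \<partial>M)"
proof (induction n)
  case (Suc n)
  have "(\<integral>x. f ((T ^^ Suc n) x) \<partial>M) = (\<integral>x. f ((T ^^ n) (T x)) \<partial>M)"
    by (simp add: funpow_swap1)
  also have "\<dots> = (\<integral>x. f ((T ^^ n) x) \<partial>M)"
    by (rule integral_comp[where f = "\<lambda>x. f ((T ^^ n) x)"]) measurable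
  finally show ?case using Suc by simp
qed simp

lemma integrable_max_partial_sum:
  assumes "integrable M g"
  shows "integrable M (max_partial_sum T g n)"
proof (induction n)
  case (Suc n)
  have "integrable M (\<lambda>x. max 0 (g x + max_partial_sum T g n (T x)))"
    using assms integrable_comp[OF Suc] by simp
  then show ?case by simp
qed simp

text \<open>Garsia's argument: where \<open>F = max_partial_sum T g n\<close> is positive, \<open>F - F \<circ> T \<le> g\<close>.\<close>

lemma maximal_ergodic_inequality:
  assumes g: "integrable M g"
  shows "0 \<le> (\<integral>x. g x * indicator {x \<in> space M. 0 < max_partial_sum T g n x} x \<partial>M)"
proof -
  let ?F = "max_partial_sum T g n" and ?P = "{x \<in> space M. 0 < max_partial_sum T g n x}"
  have F: "integrable M ?F" by (rule integrable_max_partial_sum[OF g])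
  then have [measurable]: "?F \<in> borel_measurable M" by simp
  have pointwise: "?F x - ?F (T x) \<le> g x * indicator ?P x" if "x \<in> space M" for x
  proof (cases "0 < ?F x")
    case True
    then obtain k where k: "n = Suc k" by (cases n) auto
    have "?F x = g x + max_partial_sum T g k (T x)" using True k by simp
    also have "\<dots> \<le> g x + ?F (T x)" using max_partial_sum_mono[of k n T g "T x"] k by simp
    finally show ?thesis using True that by simp
  next
    case False
    then show ?thesis using max_partial_sum_nonneg[of T g n "T x"] by simp
  qed
  have "0 = (\<integral>x. ?F x - ?F (T x) \<partial>M)"
    using F integrable_comp[OF F] integral_comp[of ?F] by simp
  also have "\<dots> \<le> (\<integral>x. g x * indicator ?P x \<partial>M)"
    using F integrable_comp[OF F] g pointwise
    by (intro integral_mono) (auto intro!: integrable_real_mult_indicator)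
  finally show ?thesis .
qed

lemma integral_nonneg_if_AE_birkhoff_sum_pos:
  assumes g: "integrable M g" and pos: "AE x in M. \<exists>n. 0 < birkhoff_sum T g n x"
  shows "0 \<le> (\<integral>x. g x \<partial>M)"
proof -
  let ?F = "max_partial_sum T g" and ?P = "\<lambda>n. {x \<in> space M. 0 < max_partial_sum T g n x}"
  have [measurable]: "?F n \<in> borel_measurable M" "g \<in> borel_measurable M" for n
    using integrable_max_partial_sum[OF g] g by auto
  have "(\<lambda>n. \<integral>x. g x * indicator (?P n) x \<partial>M) \<longlonglongrightarrow> (\<integral>x. g x \<partial>M)"
  proof (rule integral_dominated_convergence[where w = "\<lambda>x. \<bar>g x\<bar>"])
    show "AE x in M. (\<lambda>n. g x * indicator (?P n) x) \<longlonglongrightarrow> g x"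
      using pos AE_space
    proof eventually_elim
      case (elim x)
      then obtain n where "0 < birkhoff_sum T g n x" by auto
      then have "0 < ?F m x" if "n \<le> m" for m
        using birkhoff_sum_le_max_partial_sum[of T g n x] max_partial_sum_mono[OF that, of T g x] by simp
      then have "\<forall>\<^sub>F m in sequentially. g x = g x * indicator (?P m) x"
        unfolding eventually_sequentially using elim(2) by (intro exI[of _ n]) simp
      then show ?case by (rule Lim_transform_eventually[OF tendsto_const])
    qed
    show "integrable M (\<lambda>x. \<bar>g x\<bar>)" using g by (rule integrable_abs)
    show "AE x in M. norm (g x * indicator (?P n) x) \<le> \<bar>g x\<bar>" for n
      by (rule AE_I2) (simp add: indicator_def)
  qed measurable
  then show ?thesis
    by (rule LIMSEQ_le_const) (blast intro: maximal_ergodic_inequality[OF g])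
qed

lemma integral_ge_if_AE_limsup_birkhoff_average_gt:
  assumes g: "integrable M g"
    and gt: "AE x in M. ereal t < limsup (\<lambda>n. ereal (birkhoff_sum T g n x / real n))"
  shows "t \<le> (\<integral>x. g x \<partial>M)"
proof -
  have "AE x in M. \<exists>n. 0 < birkhoff_sum T (\<lambda>x. g x - t) n x"
    using gt
  proof eventually_elim
    case (elim x)
    have "\<exists>\<^sub>F n in sequentially. ereal t < ereal (birkhoff_sum T g n x / real n)"
      using elim Limsup_bounded[of "\<lambda>n. ereal (birkhoff_sum T g n x / real n)" "ereal t" sequentially]
      unfolding frequently_def not_less by (auto dest: leD)
    then have "\<exists>\<^sub>F n in sequentially. ereal t < ereal (birkhoff_sum T g n x / real n) \<and> 0 < n"
      by (rule frequently_eventually_frequently) (rule eventually_gt_at_top)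
    then obtain n where "ereal t < ereal (birkhoff_sum T g n x / real n)" "0 < n"
      by (auto dest: frequently_ex)
    then show ?case
      by (intro exI[of _ n]) (simp add: birkhoff_sum_diff_const field_simps)
  qed
  then have "0 \<le> (\<integral>x. g x - t \<partial>M)"
    using g by (intro integral_nonneg_if_AE_birkhoff_sum_pos) auto
  then show ?thesis using g by (simp add: prob_space)
qed

end

locale ergodic_system = measure_preserving +
  assumes ergodic: "B \<in> events \<Longrightarrow> T -` B \<inter> space M = B \<Longrightarrow> prob B = 0 \<or> prob B = 1"
begin

lemma AE_limsup_birkhoff_average_le_if_integral_less:
  assumes g: "integrable M g" and less: "(\<integral>x. g x \<partial>M) < t"
  shows "AE x in M. limsup (\<lambda>n. ereal (birkhoff_sum T g n x / real n)) \<le> ereal t"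
proof -
  let ?L = "\<lambda>x. limsup (\<lambda>n. ereal (birkhoff_sum T g n x / real n))"
  have [measurable]: "g \<in> borel_measurable M" using g by simp
  define B where "B = {x \<in> space M. ereal t < ?L x}"
  have B: "B \<in> events" unfolding B_def by measurable
  have "prob B \<noteq> 1"
  proof
    assume "prob B = 1"
    then have "AE x in M. x \<in> B" by (rule AE_prob_1)
    then have "AE x in M. ereal t < ?L x" by (rule AE_mp) (simp add: B_def)
    then have "t \<le> (\<integral>x. g x \<partial>M)" by (rule integral_ge_if_AE_limsup_birkhoff_average_gt[OF g])
    then show False using less by simp
  qed
  moreover have "T -` B \<inter> space M = B"
    unfolding B_def using measurable_space[OF measurable_T]
    by (auto simp: limsup_birkhoff_average_invariant)
  ultimately have "prob B = 0" using ergodic[OF B] by blast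
  then have "AE x in M. x \<notin> B" using B by (simp add: prob_eq_0)
  then show ?thesis by (rule AE_mp) (auto simp: B_def not_less)
qed

lemma AE_limsup_birkhoff_average_le:
  assumes g: "integrable M g"
  shows "AE x in M. limsup (\<lambda>n. ereal (birkhoff_sum T g n x / real n)) \<le> ereal (\<integral>x. g x \<partial>M)"
proof -
  let ?L = "\<lambda>x. limsup (\<lambda>n. ereal (birkhoff_sum T g n x / real n))" and ?I = "\<integral>x. g x \<partial>M"
  have "AE x in M. \<forall>k. ?L x \<le> ereal (?I + 1 / real (Suc k))"
    unfolding AE_all_countable
    by (intro allI AE_limsup_birkhoff_average_le_if_integral_less[OF g]) simp
  then show ?thesis
  proof eventually_elim
    case (elim x)
    have "(\<lambda>k. ?I + 1 / real (Suc k)) \<longlonglongrightarrow> ?I + 0"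
      by (intro tendsto_add tendsto_const LIMSEQ_Suc[OF lim_1_over_n])
    then have "(\<lambda>k. ereal (?I + 1 / real (Suc k))) \<longlonglongrightarrow> ereal ?I" by simp
    then show ?case by (rule LIMSEQ_le_const) (use elim in blast)
  qed
qed

theorem birkhoff_ergodic_theorem:
  assumes g: "integrable M g"
  shows "AE x in M. (\<lambda>n. birkhoff_sum T g n x / real n) \<longlonglongrightarrow> (\<integral>x. g x \<partial>M)"
proof -
  have "integrable M (\<lambda>x. - g x)" using g by simp
  from AE_limsup_birkhoff_average_le[OF g] AE_limsup_birkhoff_average_le[OF this]
  show ?thesis
  proof eventually_elim
    case (elim x)
    have "limsup (\<lambda>n. - ereal (birkhoff_sum T g n x / real n)) \<le> - ereal (\<integral>x. g x \<partial>M)"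
      using elim(2) by (simp add: birkhoff_sum_uminus)
    then have "ereal (\<integral>x. g x \<partial>M) \<le> liminf (\<lambda>n. ereal (birkhoff_sum T g n x / real n))"
      unfolding ereal_Limsup_uminus ereal_minus_le_minus .
    with elim(1) show ?case by (rule limsup_le_liminf_real)
  qed
qed

lemma integral_visits_tendsto:
  assumes [measurable]: "A \<in> events" "G \<in> events"
  shows "(\<lambda>N. \<integral>x. indicator G x * (birkhoff_sum T (indicator A) N (T x) / real N) \<partial>M)
    \<longlonglongrightarrow> prob G * prob A"
proof -
  have "(\<lambda>N. \<integral>x. indicator G x * (birkhoff_sum T (indicator A) N (T x) / real N) \<partial>M)
      \<longlonglongrightarrow> (\<integral>x. indicator G x * prob A \<partial>M)"
  proof (rule integral_dominated_convergence[where w = "\<lambda>_. 1"])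
    have "AE x in M. (\<lambda>N. birkhoff_sum T (indicator A) N (T x) / real N) \<longlonglongrightarrow> prob A"
      using AE_comp[OF birkhoff_ergodic_theorem[of "indicator A"]] by (simp add: emeasure_eq_measure)
    then show "AE x in M. (\<lambda>N. indicator G x * (birkhoff_sum T (indicator A) N (T x) / real N))
        \<longlonglongrightarrow> indicator G x * prob A"
      by eventually_elim (rule tendsto_mult_left)
    show "AE x in M. norm (indicator G x * (birkhoff_sum T (indicator A) N (T x) / real N)) \<le> 1" for N
      using birkhoff_sum_indicator_bounds[of T A N]
      by (intro AE_I2) (auto simp: indicator_def divide_le_eq_1)
  qed auto
  then show ?thesis by simp
qed

lemma card_mult_prob_le_integral_visits:
  assumes [measurable]: "A \<in> events" "G \<in> events"
    and avoid: "\<And>x d. x \<in> G \<Longrightarrow> d \<in> D \<Longrightarrow> (T ^^ d) x \<notin> A"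
  shows "real (card (D \<inter> {1..N})) * prob A
    \<le> (\<integral>x. indicator (space M - G) x * birkhoff_sum T (indicator A) N (T x) \<partial>M)"
proof -
  have integrable_visit: "integrable M (\<lambda>x. indicator A ((T ^^ d) x) :: real)" for d
    by (rule integrable_const_bound[where B = 1]) (auto simp: indicator_def)
  have visits_le: "(\<Sum>d\<in>D \<inter> {1..N}. indicator A ((T ^^ d) x))
      \<le> indicator (space M - G) x * birkhoff_sum T (indicator A) N (T x)" if "x \<in> space M" for x
  proof (cases "x \<in> G")
    case True
    then have "(\<Sum>d\<in>D \<inter> {1..N}. indicator A ((T ^^ d) x) :: real) = 0"
      using avoid by (intro sum.neutral) auto
    then show ?thesis using True by simp
  next
    case False
    have "(\<Sum>d\<in>D \<inter> {1..N}. indicator A ((T ^^ d) x)) \<le> (\<Sum>d\<in>{1..N}. indicator A ((T ^^ d) x) :: real)"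
      by (rule sum_mono2) auto
    also have "\<dots> = birkhoff_sum T (indicator A) N (T x)"
      by (simp add: birkhoff_sum_def sum.atLeast1_atMost_eq funpow_swap1)
    finally show ?thesis using False that by simp
  qed
  have "real (card (D \<inter> {1..N})) * prob A = (\<Sum>d\<in>D \<inter> {1..N}. \<integral>x. indicator A ((T ^^ d) x) \<partial>M)"
    using integral_comp_funpow[of "indicator A :: 'a \<Rightarrow> real"] by simp
  also have "\<dots> = (\<integral>x. (\<Sum>d\<in>D \<inter> {1..N}. indicator A ((T ^^ d) x)) \<partial>M)"
    by (rule Bochner_Integration.integral_sum[symmetric]) (rule integrable_visit)
  also have "\<dots> \<le> (\<integral>x. indicator (space M - G) x * birkhoff_sum T (indicator A) N (T x) \<partial>M)"
  proof (rule integral_mono[OF _ _ visits_le])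
    show "integrable M (\<lambda>x. indicator (space M - G) x * birkhoff_sum T (indicator A) N (T x))"
      using birkhoff_sum_indicator_bounds[of T A N]
      by (intro integrable_const_bound[where B = "real N"]) (auto simp: indicator_def)
  qed (intro Bochner_Integration.integrable_sum integrable_visit)
  finally show ?thesis .
qed

proposition upper_density_le_if_orbits_avoid:
  assumes A: "A \<in> events" "0 < prob A" and G [measurable]: "G \<in> events"
    and avoid: "\<And>x d. x \<in> G \<Longrightarrow> d \<in> D \<Longrightarrow> (T ^^ d) x \<notin> A"
  shows "upper_density D \<le> ereal (1 - prob G)"
proof -
  let ?v = "\<lambda>N. (\<integral>x. indicator (space M - G) x * (birkhoff_sum T (indicator A) N (T x) / real N) \<partial>M)"
  have "(\<lambda>N. ?v N / prob A) \<longlonglongrightarrow> prob (space M - G) * prob A / prob A"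
    using A by (intro tendsto_divide integral_visits_tendsto tendsto_const) auto
  then have lim: "(\<lambda>N. ereal (?v N / prob A)) \<longlonglongrightarrow> ereal (1 - prob G)"
    using A prob_compl[OF G] by simp
  have "real (card (D \<inter> {1..N})) / real N \<le> ?v N / prob A" for N
  proof -
    have "real (card (D \<inter> {1..N})) * prob A / real N \<le> ?v N"
      using divide_right_mono[of _ _ "real N", OF card_mult_prob_le_integral_visits[OF A(1) G avoid]]
      by simp
    then show ?thesis by (subst pos_le_divide_eq[OF A(2)]) simp
  qed
  then have "upper_density D \<le> limsup (\<lambda>N. ereal (?v N / prob A))"
    unfolding upper_density_def by (intro Limsup_mono always_eventually allI) simp
  also have "\<dots> = ereal (1 - prob G)"
    using lim by (intro lim_imp_Limsup) simp_all
  finally show ?thesis .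
qed

end

lemma ergodic_system_borel:
  assumes "continuous_on UNIV T"
    and "borel_prob_measure m" "invariant_measure T m" "ergodic_measure T m"
  shows "ergodic_system m T"
proof -
  have sets: "sets m = sets borel" and "prob_space m"
    using assms(2) by (auto simp: borel_prob_measure_def)
  interpret prob_space m by fact
  have space: "space m = UNIV" using sets_eq_imp_space_eq[OF sets] by simp
  have T: "T \<in> measurable m m"
    using borel_measurable_continuous_onI[OF assms(1)] sets by (simp cong: measurable_cong_sets)
  show ?thesis
  proof
    show "distr m m T = m"
      using assms(3) T by (intro measure_eqI) (simp_all add: emeasure_distr space sets invariant_measure_def)
    show "prob B = 0 \<or> prob B = 1" if "B \<in> events" "T -` B \<inter> space m = B" for B
      using that assms(4) by (simp add: ergodic_measure_def sets space emeasure_eq_measure)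
  qed (rule T)
qed

proposition no_ergodic_full_support_if_balls_avoid:
  fixes T :: "'a::metric_space \<Rightarrow> 'a"
  assumes T: "continuous_on UNIV T" and D: "0 < upper_density D"
    and avoid: "\<And>r. \<exists>U. open U \<and> U \<noteq> {} \<and> (\<forall>x\<in>cball a r. \<forall>d\<in>D. (T ^^ d) x \<notin> U)"
    and m: "borel_prob_measure m" "invariant_measure T m" "ergodic_measure T m"
  shows "\<not> full_support m"
proof
  assume full: "full_support m"
  interpret ergodic_system m T by (rule ergodic_system_borel[OF T m])
  have sets: "sets m = sets borel" using m(1) by (simp add: borel_prob_measure_def)
  have "(\<Union>n. cball a (real n)) = space m"
    using real_arch_simple sets_eq_imp_space_eq[OF sets] by auto
  moreover have "(\<lambda>n. prob (cball a (real n))) \<longlonglongrightarrow> prob (\<Union>n. cball a (real n))"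
    by (rule finite_Lim_measure_incseq) (auto simp: sets incseq_def)
  ultimately have "(\<lambda>n. prob (cball a (real n))) \<longlonglongrightarrow> 1" by (simp add: prob_space)
  then have lim: "(\<lambda>n. ereal (1 - prob (cball a (real n)))) \<longlonglongrightarrow> ereal (1 - 1)"
    by (intro tendsto_ereal tendsto_diff tendsto_const)
  have bound: "upper_density D \<le> ereal (1 - prob (cball a (real n)))" for n
  proof -
    obtain U where U: "open U" "U \<noteq> {}" "\<forall>x\<in>cball a (real n). \<forall>d\<in>D. (T ^^ d) x \<notin> U"
      using avoid by blast
    then have "0 < prob U" using full by (simp add: full_support_def emeasure_eq_measure)
    then show ?thesis using U by (intro upper_density_le_if_orbits_avoid[of U]) (auto simp: sets)
  qed
  have "upper_density D \<le> ereal (1 - 1)"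
    using LIMSEQ_le_const[OF lim] bound by blast
  then show False using D by (simp add: zero_ereal_def)
qed

section \<open>Weighted backward shifts\<close>

definition coord :: "c0 \<Rightarrow> int \<Rightarrow> real" where
  "coord x = apply_bcontfun (c0_rep x)"

definition c0_of :: "(int \<Rightarrow> real) \<Rightarrow> c0" where
  "c0_of f = Abs_c0 (Bcontfun f)"

lemma tendsto_0_cofinite_iff:
  fixes f :: "int \<Rightarrow> real"
  shows "(f \<longlongrightarrow> 0) cofinite \<longleftrightarrow> (\<forall>e>0. finite {j. e \<le> \<bar>f j\<bar>})"
  by (simp add: tendsto_iff eventually_cofinite not_less)

lemma finite_coord_ge: "0 < e \<Longrightarrow> finite {j. e \<le> \<bar>coord x j\<bar>}"
  using c0_rep[of x] tendsto_0_cofinite_iff[of "coord x"] by (simp add: c0_set_def coord_def)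

lemma coord_c0_of:
  assumes "\<And>e. 0 < e \<Longrightarrow> finite {j. e \<le> \<bar>f j\<bar>}"
  shows "coord (c0_of f) = f"
proof -
  have "finite ((\<lambda>j. \<bar>f j\<bar>) ` {j. 1 \<le> \<bar>f j\<bar>})" using assms by (intro finite_imageI) simp
  then have "bdd_above ((\<lambda>j. \<bar>f j\<bar>) ` {j. 1 \<le> \<bar>f j\<bar>})" by (rule bdd_above_finite)
  then obtain b where b: "1 \<le> \<bar>f j\<bar> \<Longrightarrow> \<bar>f j\<bar> \<le> b" for j
    unfolding bdd_above.unfold by auto
  have "\<bar>f j\<bar> \<le> max 1 b" for j using b[of j] by linarith
  then have "f \<in> bcontfun"
    by (intro bcontfun_normI[where b = "max 1 b"])
      (simp_all only: real_norm_def Topological_Spaces.continuous_on_discrete)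
  then have f: "apply_bcontfun (Bcontfun f) = f" by (rule Bcontfun_inverse)
  then have "Bcontfun f \<in> c0_set" using assms tendsto_0_cofinite_iff[of f] by (simp add: c0_set_def)
  then show ?thesis using f by (simp add: coord_def c0_of_def Abs_c0_inverse)
qed

lemma c0_eqI: "(\<And>j. coord x j = coord y j) \<Longrightarrow> x = y"
  unfolding coord_def by (intro c0_rep_inject[THEN iffD1] bcontfun_eqI)

lemma abs_coord_le_norm: "\<bar>coord x j\<bar> \<le> norm x"
  unfolding coord_def norm_c0.rep_eq using norm_bounded[of "c0_rep x" j] by simp

lemma norm_c0_le: "(\<And>j. \<bar>coord x j\<bar> \<le> b) \<Longrightarrow> norm x \<le> b"
  unfolding coord_def norm_c0.rep_eq by (intro norm_bound) simp

lemma coord_add: "coord (x + y) j = coord x j + coord y j"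
  by (simp add: coord_def plus_c0.rep_eq)

lemma coord_diff: "coord (x - y) j = coord x j - coord y j"
  by (simp add: coord_def minus_c0.rep_eq)

lemma coord_scaleR: "coord (r *\<^sub>R x) j = r * coord x j"
  by (simp add: coord_def scaleR_c0.rep_eq)

lemma bounded_linear_coord: "bounded_linear (\<lambda>x. coord x j)"
  by (rule bounded_linear_intro[of _ 1]) (auto simp: coord_add coord_scaleR abs_coord_le_norm)

lemma open_abs_coord_gt: "open {x. r < \<bar>coord x j\<bar>}"
proof -
  have "continuous_on UNIV (\<lambda>x. coord x j)" by (rule linear_continuous_on[OF bounded_linear_coord])
  then show ?thesis by (intro open_Collect_less continuous_intros)
qed

lemma ex_abs_coord_gt: "\<exists>x. r < \<bar>coord x j\<bar>"
proof -
  define f where "f = (\<lambda>i. if i = j then \<bar>r\<bar> + 1 else 0)"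
  have "finite {i. e \<le> \<bar>f i\<bar>}" if "0 < e" for e
    by (rule finite_subset[of _ "{j}"]) (use that in \<open>auto simp: f_def split: if_splits\<close>)
  then have "coord (c0_of f) = f" by (rule coord_c0_of)
  then have "r < \<bar>coord (c0_of f) j\<bar>" by (simp add: f_def)
  then show ?thesis ..
qed

locale c0_weighted_shift =
  fixes W :: "int \<Rightarrow> real" and C :: real
  assumes W_pos: "0 < W j"
    and W_growth: "W (j + 1) \<le> C * W j"
begin

definition shift :: "c0 \<Rightarrow> c0" where
  "shift x = c0_of (\<lambda>j. W (j + 1) / W j * coord x (j + 1))"

lemma abs_weight_mult_le: "\<bar>W (j + 1) / W j * c\<bar> \<le> C * \<bar>c\<bar>"
proof -
  have "W (j + 1) / W j \<le> C" using W_growth[of j] W_pos[of j] by (simp add: pos_divide_le_eq)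
  then have "W (j + 1) / W j * \<bar>c\<bar> \<le> C * \<bar>c\<bar>" by (rule mult_right_mono) simp
  then show ?thesis using W_pos by (simp add: abs_mult less_imp_le)
qed

lemma C_pos: "0 < C"
proof (rule zero_less_mult_pos2)
  show "0 < C * W 0" using W_growth[of 0] W_pos[of 1] by simp
qed (rule W_pos)

lemma coord_shift: "coord (shift x) j = W (j + 1) / W j * coord x (j + 1)"
proof -
  have "finite {j. e \<le> \<bar>W (j + 1) / W j * coord x (j + 1)\<bar>}" if "0 < e" for e
  proof (rule finite_subset)
    show "finite ((\<lambda>j. j + 1) -` {j. e / C \<le> \<bar>coord x j\<bar>})"
      using that C_pos by (intro finite_vimageI finite_coord_ge) (auto simp: inj_def)
    have "e / C \<le> \<bar>coord x (j + 1)\<bar>" if "e \<le> \<bar>W (j + 1) / W j * coord x (j + 1)\<bar>" for j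
      using order_trans[OF that abs_weight_mult_le] C_pos by (simp add: pos_divide_le_eq mult.commute)
    then show "{j. e \<le> \<bar>W (j + 1) / W j * coord x (j + 1)\<bar>} \<subseteq> (\<lambda>j. j + 1) -` {j. e / C \<le> \<bar>coord x j\<bar>}"
      by blast
  qed
  then show ?thesis unfolding shift_def by (simp add: coord_c0_of)
qed

lemma coord_shift_funpow: "coord ((shift ^^ n) x) j = W (j + int n) / W j * coord x (j + int n)"
proof (induction n arbitrary: j)
  case 0
  show ?case using W_pos[of j] by simp
next
  case (Suc n)
  show ?case using W_pos[of "j + 1"] by (simp add: coord_shift Suc algebra_simps)
qed

lemma bounded_linear_shift: "bounded_linear shift"
proof (rule bounded_linear_intro[of _ C])
  show "shift (x + y) = shift x + shift y" for x y
    by (rule c0_eqI) (simp add: coord_shift coord_add distrib_left)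
  show "shift (r *\<^sub>R x) = r *\<^sub>R shift x" for r x
    by (rule c0_eqI) (simp add: coord_shift coord_scaleR)
  show "norm (shift x) \<le> norm x * C" for x
  proof (rule norm_c0_le)
    fix j
    have "\<bar>coord (shift x) j\<bar> \<le> C * \<bar>coord x (j + 1)\<bar>" unfolding coord_shift by (rule abs_weight_mult_le)
    also have "\<dots> \<le> norm x * C" using abs_coord_le_norm[of x "j + 1"] C_pos by simp
    finally show "\<bar>coord (shift x) j\<bar> \<le> norm x * C" .
  qed
qed

proposition shift_no_ergodic_full_support:
  assumes D: "0 < upper_density {n. W (int n) \<le> K}"
    and m: "borel_prob_measure m" "invariant_measure shift m" "ergodic_measure shift m"
  shows "\<not> full_support m"
proof (rule no_ergodic_full_support_if_balls_avoid[OF _ D _ m, where a = 0])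
  show "continuous_on UNIV shift" by (intro linear_continuous_on bounded_linear_shift)
  fix r
  let ?U = "{x. K / W 0 * r < \<bar>coord x 0\<bar>}"
  have "(shift ^^ n) x \<notin> ?U" if "x \<in> cball 0 r" "W (int n) \<le> K" for x n
  proof -
    have "\<bar>coord x (int n)\<bar> \<le> r" using that(1) abs_coord_le_norm[of x "int n"] by simp
    moreover have "0 \<le> K" using that(2) W_pos[of "int n"] by simp
    ultimately have "W (int n) / W 0 * \<bar>coord x (int n)\<bar> \<le> K / W 0 * r"
      using that(2) W_pos[of 0] by (intro mult_mono divide_right_mono) auto
    then show ?thesis using W_pos by (simp add: coord_shift_funpow abs_mult less_imp_le not_less)
  qed
  then show "\<exists>U. open U \<and> U \<noteq> {} \<and> (\<forall>x\<in>cball 0 r. \<forall>n\<in>{n. W (int n) \<le> K}. (shift ^^ n) x \<notin> U)"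
    using ex_abs_coord_gt by (intro exI[of _ ?U]) (auto simp: open_abs_coord_gt)
qed

end

section \<open>A criterion for frequent hypercyclicity\<close>

definition rat_seq :: "rat list \<Rightarrow> int \<Rightarrow> real" where
  "rat_seq l i = (if int_encode i < length l then of_rat (l ! int_encode i) else 0)"

lemma rat_seq_dense:
  assumes "0 < e"
  obtains l where "\<And>i. \<bar>rat_seq l i - coord x i\<bar> < e"
proof -
  have "finite (int_encode ` {i. e \<le> \<bar>coord x i\<bar>})"
    using assms by (intro finite_imageI finite_coord_ge)
  then obtain K where K: "e \<le> \<bar>coord x i\<bar> \<Longrightarrow> int_encode i < K" for i
    unfolding finite_nat_set_iff_bounded by auto
  have "\<exists>q. \<bar>of_rat q - coord x (int_decode k)\<bar> < e" for k
  proof -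
    obtain q where "coord x (int_decode k) - e < of_rat q" "of_rat q < coord x (int_decode k) + e"
      using of_rat_dense[of "coord x (int_decode k) - e" "coord x (int_decode k) + e"] assms by auto
    then show ?thesis by (auto simp: abs_diff_less_iff)
  qed
  then obtain q where q: "\<bar>of_rat (q k) - coord x (int_decode k)\<bar> < e" for k by metis
  have "\<bar>rat_seq (map q [0..<K]) i - coord x i\<bar> < e" for i
  proof (cases "int_encode i < K")
    case True
    then show ?thesis using q[of "int_encode i"] by (simp add: rat_seq_def)
  next
    case False
    then have "\<not> e \<le> \<bar>coord x i\<bar>" using K by blast
    then show ?thesis using False by (simp add: rat_seq_def)
  qed
  then show thesis by (rule that)
qed

definition confined :: "nat \<Rightarrow> (int \<Rightarrow> real) \<Rightarrow> bool" where
  "confined p f \<longleftrightarrow> (\<forall>i. \<bar>f i\<bar> \<le> real p \<and> (f i \<noteq> 0 \<longrightarrow> \<bar>i\<bar> \<le> int p))"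

lemma eventually_confined_rat_seq: "\<forall>\<^sub>F p in sequentially. confined p (rat_seq l)"
proof -
  let ?size = "\<lambda>i. nat \<lceil>\<bar>rat_seq l i\<bar>\<rceil> + nat \<bar>i\<bar>"
  have "i \<in> int_decode ` {..<length l}" if "rat_seq l i \<noteq> 0" for i
    using that by (intro image_eqI[of _ _ "int_encode i"]) (auto simp: rat_seq_def split: if_splits)
  then have "{i. rat_seq l i \<noteq> 0} \<subseteq> int_decode ` {..<length l}" by blast
  then have "finite (?size ` {i. rat_seq l i \<noteq> 0})"
    by (intro finite_imageI finite_subset[of _ "int_decode ` {..<length l}"]) auto
  then obtain M where M: "\<And>i. rat_seq l i \<noteq> 0 \<Longrightarrow> ?size i \<le> M"
    unfolding finite_nat_set_iff_bounded_le by auto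
  have "confined p (rat_seq l)" if "M \<le> p" for p
    unfolding confined_def
  proof
    fix i
    show "\<bar>rat_seq l i\<bar> \<le> real p \<and> (rat_seq l i \<noteq> 0 \<longrightarrow> \<bar>i\<bar> \<le> int p)"
    proof (cases "rat_seq l i = 0")
      case False
      then have size: "nat \<lceil>\<bar>rat_seq l i\<bar>\<rceil> \<le> p" "nat \<bar>i\<bar> \<le> p"
        using M[OF False] that by linarith+
      have "\<bar>rat_seq l i\<bar> \<le> real (nat \<lceil>\<bar>rat_seq l i\<bar>\<rceil>)" by (rule of_nat_ceiling)
      also have "\<dots> \<le> real p" using size(1) by (simp only: of_nat_le_iff)
      finally show ?thesis using size(2) by (simp add: nat_le_iff)
    qed simp
  qed
  then show ?thesis unfolding eventually_sequentially by blast
qed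

text \<open>The second component of the decoded pair is padding: every \<open>rat_seq l\<close> recurs for arbitrarily
  large \<open>p\<close>, and is eventually confined.\<close>

definition pattern :: "nat \<Rightarrow> int \<Rightarrow> real" where
  "pattern p = (let f = rat_seq (from_nat (fst (prod_decode p))) in if confined p f then f else (\<lambda>_. 0))"

lemma abs_pattern_le: "\<bar>pattern p i\<bar> \<le> real p"
  by (simp add: pattern_def Let_def confined_def)

lemma pattern_eq_0: "int p < \<bar>i\<bar> \<Longrightarrow> pattern p i = 0"
  by (fastforce simp: pattern_def Let_def confined_def)

lemma pattern_dense:
  assumes "0 < e"
  obtains p where "P \<le> p" "\<And>i. \<bar>pattern p i - coord x i\<bar> < e"
proof -
  obtain l where l: "\<And>i. \<bar>rat_seq l i - coord x i\<bar> < e" using rat_seq_dense[OF assms] by blast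
  obtain M where M: "\<And>p. M \<le> p \<Longrightarrow> confined p (rat_seq l)"
    using eventually_confined_rat_seq unfolding eventually_sequentially by blast
  define p where "p = prod_encode (to_nat l, max P M)"
  have p: "max P M \<le> p" unfolding p_def by (rule le_prod_encode_2)
  then have "confined p (rat_seq l)" by (intro M) simp
  then have "pattern p = rat_seq l" by (simp add: pattern_def p_def)
  then show thesis using l p by (intro that[of p]) simp_all
qed

definition window :: "(nat \<Rightarrow> nat set) \<Rightarrow> int \<Rightarrow> nat \<Rightarrow> nat \<Rightarrow> bool" where
  "window E k q m \<longleftrightarrow> m \<in> E q \<and> \<bar>k - int m\<bar> \<le> int q"

text \<open>The factor \<open>4 ^ q\<close> makes up for the weighted size of the pattern with index \<open>q\<close>, and \<open>2 ^ p\<close> is the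
  precision required of visits at times in \<open>E p\<close>.\<close>

locale c0_weighted_shift_with_sites = c0_weighted_shift +
  fixes E :: "nat \<Rightarrow> nat set"
  assumes W_le: "W i \<le> 2 ^ nat \<bar>i\<bar>"
    and sites_dense: "0 < lower_density (E p)"
    and sites_disjoint: "n \<in> E p \<Longrightarrow> n \<in> E q \<Longrightarrow> p = q"
    and windows_separated: "window E k q m \<Longrightarrow> n \<in> E p \<Longrightarrow> n \<noteq> m \<Longrightarrow> 4 ^ q * 2 ^ p < W (k - int n)"
    and windows_escape: "finite {k. \<exists>q m. window E k q m \<and> W k \<le> B * 4 ^ q}"
begin

lemma W_le_window:
  assumes "window E k q m"
  shows "W (k - int m) \<le> 2 ^ q"
proof -
  have "nat \<bar>k - int m\<bar> \<le> q" using assms by (simp add: window_def nat_le_iff)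
  then have "(2::real) ^ nat \<bar>k - int m\<bar> \<le> 2 ^ q" by (intro power_increasing) auto
  then show ?thesis by (rule order_trans[OF W_le])
qed

lemma window_unique:
  assumes "window E k q m" "window E k p n"
  shows "q = p \<and> m = n"
proof -
  have "m = n"
  proof (rule ccontr)
    assume "m \<noteq> n"
    then have "4 ^ q * 2 ^ p < W (k - int n)"
      using assms by (intro windows_separated) (auto simp: window_def)
    also have "\<dots> \<le> 1 * 2 ^ p" using W_le_window[OF assms(2)] by simp
    finally have "(4::real) ^ q < 1" by (simp only: mult_less_cancel_right) simp
    moreover have "1 \<le> (4::real) ^ q" by simp
    ultimately show False by linarith
  qed
  then show ?thesis using assms sites_disjoint by (auto simp: window_def)
qed

text \<open>At most one summand, by \<open>window_unique\<close>.\<close>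

definition fhc_coord :: "int \<Rightarrow> real" where
  "fhc_coord k = (\<Sum>(q, m)\<in>{(q, m). window E k q m}. W (k - int m) / W k * pattern q (k - int m))"

lemma fhc_coord_window:
  assumes "window E k q m"
  shows "fhc_coord k = W (k - int m) / W k * pattern q (k - int m)"
proof -
  have "{(q, m). window E k q m} = {(q, m)}" using assms window_unique by auto
  then show ?thesis by (simp add: fhc_coord_def)
qed

lemma fhc_coord_outside: "(\<And>q m. \<not> window E k q m) \<Longrightarrow> fhc_coord k = 0"
  by (simp add: fhc_coord_def)

lemma W_mult_fhc_coord_le:
  assumes "window E k q m"
  shows "W k * \<bar>fhc_coord k\<bar> \<le> 4 ^ q"
proof -
  have "\<bar>pattern q (k - int m)\<bar> \<le> 2 ^ q"
    using abs_pattern_le[of q "k - int m"] of_nat_less_two_power[of q, where ?'a = real] by linarith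
  then have "W (k - int m) * \<bar>pattern q (k - int m)\<bar> \<le> 2 ^ q * 2 ^ q"
    using W_le_window[OF assms] by (intro mult_mono) auto
  moreover have "W k * \<bar>fhc_coord k\<bar> = W (k - int m) * \<bar>pattern q (k - int m)\<bar>"
    using W_pos[of k] W_pos[of "k - int m"] by (simp add: fhc_coord_window[OF assms] abs_mult)
  ultimately show ?thesis by (simp flip: power_mult_distrib)
qed

definition fhc_vector :: c0 where
  "fhc_vector = c0_of fhc_coord"

lemma coord_fhc_vector: "coord fhc_vector = fhc_coord"
  unfolding fhc_vector_def
proof (rule coord_c0_of)
  fix e :: real assume e: "0 < e"
  have "\<exists>q m. window E k q m \<and> W k \<le> 1 / e * 4 ^ q" if k: "e \<le> \<bar>fhc_coord k\<bar>" for k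
  proof -
    have "fhc_coord k \<noteq> 0" using k e by auto
    then obtain q m where window: "window E k q m" using fhc_coord_outside by blast
    have "W k * e \<le> W k * \<bar>fhc_coord k\<bar>" using k W_pos[of k] by simp
    also have "\<dots> \<le> 4 ^ q" by (rule W_mult_fhc_coord_le[OF window])
    finally have "W k \<le> 1 / e * 4 ^ q" using e by (simp add: field_simps)
    with window show ?thesis by blast
  qed
  then show "finite {k. e \<le> \<bar>fhc_coord k\<bar>}"
    by (intro finite_subset[OF _ windows_escape[of "1 / e"]]) blast
qed

lemma shift_fhc_vector_approx:
  assumes n: "n \<in> E p"
  shows "\<bar>coord ((shift ^^ n) fhc_vector) j - pattern p j\<bar> \<le> (1 / 2) ^ p"
proof -
  let ?k = "j + int n"
  have orbit: "coord ((shift ^^ n) fhc_vector) j = W ?k / W j * fhc_coord ?k"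
    by (simp add: coord_shift_funpow coord_fhc_vector)
  consider (own) "\<bar>j\<bar> \<le> int p" | (other) q m where "int p < \<bar>j\<bar>" "window E ?k q m"
    | (none) "int p < \<bar>j\<bar>" "\<And>q m. \<not> window E ?k q m"
    using not_le by blast
  then show ?thesis
  proof cases
    case own
    then have "window E ?k p n" using n by (simp add: window_def)
    then show ?thesis
      using W_pos[of j] W_pos[of ?k] by (simp add: orbit fhc_coord_window)
  next
    case (other q m)
    then have "n \<noteq> m" using n sites_disjoint[of n p q] by (auto simp: window_def)
    then have sep: "4 ^ q * 2 ^ p < W j" using windows_separated[OF other(2) n] by simp
    have "\<bar>coord ((shift ^^ n) fhc_vector) j - pattern p j\<bar> = W ?k * \<bar>fhc_coord ?k\<bar> / W j"
      using W_pos by (simp add: orbit abs_mult less_imp_le pattern_eq_0[OF other(1)])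
    also have "\<dots> \<le> 4 ^ q / (4 ^ q * 2 ^ p)"
      using W_mult_fhc_coord_le[OF other(2)] sep by (intro frac_le) auto
    also have "\<dots> = (1 / 2) ^ p" by (simp add: power_divide)
    finally show ?thesis .
  next
    case none
    then show ?thesis by (simp add: orbit pattern_eq_0 fhc_coord_outside)
  qed
qed

proposition freq_hypercyclic_shift: "freq_hypercyclic shift"
proof (rule freq_hypercyclicI[where x = fhc_vector])
  fix V :: "c0 set" assume "open V" "V \<noteq> {}"
  then obtain y e where e: "0 < e" "ball y e \<subseteq> V" by (metis ex_in_conv openE)
  obtain P where P: "(1 / 2 :: real) ^ P < e / 3"
    using real_arch_pow_inv[of "e / 3" "1 / 2"] e by auto
  obtain p where p: "P \<le> p" "\<And>i. \<bar>pattern p i - coord y i\<bar> < e / 3"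
    using pattern_dense[of "e / 3" P y] e by auto
  have "(1 / 2 :: real) ^ p \<le> (1 / 2) ^ P" using p by (intro power_decreasing) auto
  then have small: "(1 / 2 :: real) ^ p < e / 3" using P by linarith
  have "(shift ^^ n) fhc_vector \<in> V" if n: "n \<in> E p" for n
  proof -
    have "\<bar>coord (y - (shift ^^ n) fhc_vector) j\<bar> \<le> 2 * e / 3" for j
      using p(2)[of j] shift_fhc_vector_approx[OF n, of j] small unfolding coord_diff by linarith
    then have "norm (y - (shift ^^ n) fhc_vector) \<le> 2 * e / 3" by (rule norm_c0_le)
    then have "dist y ((shift ^^ n) fhc_vector) < e" using e(1) by (simp add: dist_norm)
    then show ?thesis using e(2) by auto
  qed
  then have "lower_density (E p) \<le> lower_density {n. (shift ^^ n) fhc_vector \<in> V}"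
    by (intro lower_density_mono) blast
  then show "0 < lower_density {n. (shift ^^ n) fhc_vector \<in> V}"
    using sites_dense[of p] by simp
qed

end

section \<open>Sites and weights\<close>

definition run_length :: "int set \<Rightarrow> int \<Rightarrow> nat" where
  "run_length H d = (LEAST r. d - int r \<notin> H)"

lemma run_length_le: "d - int r \<notin> H \<Longrightarrow> run_length H d \<le> r"
  unfolding run_length_def by (rule Least_le)

lemma diff_run_length_notin:
  assumes "bdd_below H"
  shows "d - int (run_length H d) \<notin> H"
proof -
  obtain b where b: "x \<in> H \<Longrightarrow> b \<le> x" for x using assms unfolding bdd_below.unfold by auto
  have "d - int (nat (d - b + 1)) \<notin> H" using b[of "d - int (nat (d - b + 1))"] by auto
  then show ?thesis unfolding run_length_def by (rule LeastI)
qed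

lemma run_length_step:
  assumes "bdd_below H"
  shows "run_length H (d + 1) \<le> run_length H d + 1"
  using diff_run_length_notin[OF assms, of d] by (intro run_length_le) simp

lemma run_length_ge:
  assumes "bdd_below H" "{d - r<..d} \<subseteq> H"
  shows "r \<le> int (run_length H d)"
proof (rule ccontr)
  assume "\<not> ?thesis"
  then have "d - int (run_length H d) \<in> {d - r<..d}" by simp
  then show False using assms(2) diff_run_length_notin[OF assms(1), of d] by blast
qed

definition period :: "nat \<Rightarrow> nat" where
  "period p = 10 ^ (p + 2)"

definition block :: "nat \<Rightarrow> nat set" where
  "block u = {10 ^ u..<2 * 10 ^ u}"

definition sites :: "nat \<Rightarrow> nat set" where
  "sites p = {n. period p dvd n \<and> (\<exists>u\<ge>p + 2. multiplicity 2 u = p \<and> n \<in> block u)}"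

text \<open>The left margin leaves a run of \<open>3 * p + 1\<close> points below every point at distance at most \<open>p\<close> from
  a multiple.\<close>

definition near_multiples :: "nat \<Rightarrow> int set" where
  "near_multiples p = (\<Union>k\<in>{1..}. {int (period p * k) - 4 * int p..int (period p * k) + int p})"

definition around_block :: "nat \<Rightarrow> int set" where
  "around_block u = {d. 10 ^ u \<le> 2 * d \<and> d \<le> 3 * 10 ^ u}"

definition high :: "int set" where
  "high = (\<Union>p. near_multiples p) \<union> (\<Union>u. around_block u)"

text \<open>Weights may at most double per step, so \<open>elevation\<close> has to climb along the runs of \<open>high\<close>; it drops
  to 0 right after each of them.\<close>

definition elevation :: "int \<Rightarrow> nat" where
  "elevation d = nat (- d) + run_length high d"

lemma period_pos: "0 < period p"
  by (simp add: period_def)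

lemma period_ge: "40 * 2 ^ p * (5 * p + 1) \<le> period p"
proof -
  have "10 * p + 4 \<le> 5 * 5 ^ p" by (induction p) auto
  then have "20 * 2 ^ p * (10 * p + 2) \<le> 20 * 2 ^ p * (5 * 5 ^ p)" by (intro mult_left_mono) auto
  also have "\<dots> = period p" by (simp add: period_def flip: power_mult_distrib)
  finally show ?thesis by (simp add: algebra_simps)
qed

lemma period_mult_ge:
  assumes "1 \<le> k"
  shows "200 * p + 40 \<le> period p * k"
proof -
  have "40 * 1 * (5 * p + 1) \<le> 40 * 2 ^ p * (5 * p + 1)" by (intro mult_right_mono mult_left_mono) auto
  also have "\<dots> \<le> period p * 1" using period_ge[of p] by simp
  also have "\<dots> \<le> period p * k" using assms by (rule mult_left_mono) simp
  finally show ?thesis by simp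
qed

lemma near_multiples_gt:
  assumes "d \<in> near_multiples p"
  shows "int p < d"
proof -
  obtain k where "1 \<le> k" and d: "int (period p * k) - 4 * int p \<le> d"
    using assms by (auto simp: near_multiples_def)
  then have "int (200 * p + 40) \<le> int (period p * k)" by (intro of_nat_mono period_mult_ge)
  then show ?thesis using d by linarith
qed

lemma high_subset_pos: "high \<subseteq> {0<..}"
proof
  fix d assume "d \<in> high"
  then consider (multiple) p where "d \<in> near_multiples p" | (block) u :: nat where "10 ^ u \<le> 2 * d"
    by (auto simp: high_def around_block_def)
  then show "d \<in> {0<..}"
  proof cases
    case multiple
    then show ?thesis using near_multiples_gt[of d p] by simp
  next
    case block
    have "(0::int) < 10 ^ u" by simp
    then have "0 < d" using block by linarith
    then show ?thesis by simp
  qed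
qed

lemma bdd_below_high: "bdd_below high"
  using high_subset_pos by (rule bdd_below_mono[rotated]) simp

lemma elevation_step: "elevation (d + 1) \<le> elevation d + 1"
  using run_length_step[OF bdd_below_high, of d] unfolding elevation_def by linarith

lemma elevation_le_abs: "elevation d \<le> nat \<bar>d\<bar>"
proof -
  have "run_length high d \<le> nat d" using high_subset_pos by (intro run_length_le) auto
  then show ?thesis by (simp add: elevation_def)
qed

lemma elevation_eq_0:
  assumes "0 < d" "d \<notin> high"
  shows "elevation d = 0"
  using assms run_length_le[of d 0 high] by (simp add: elevation_def)

lemma elevation_ge_if_run:
  assumes "{d - r<..d} \<subseteq> high"
  shows "r \<le> int (elevation d)"
  using run_length_ge[OF bdd_below_high assms] by (simp add: elevation_def)

lemma elevation_ge_near_multiple: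
  assumes "1 \<le> k" "\<bar>d - int (period p * k)\<bar> \<le> int p"
  shows "3 * int p + 1 \<le> int (elevation d)"
proof (rule elevation_ge_if_run)
  have "{d - (3 * int p + 1)<..d} \<subseteq> {int (period p * k) - 4 * int p..int (period p * k) + int p}"
    using assms(2) by auto
  then show "{d - (3 * int p + 1)<..d} \<subseteq> high"
    using assms(1) unfolding high_def near_multiples_def by blast
qed

lemma elevation_ge_around_block:
  assumes "10 ^ u + 2 * r \<le> 2 * d + 2" "d \<le> 3 * 10 ^ u"
  shows "r \<le> int (elevation d)"
proof (rule elevation_ge_if_run)
  have "{d - r<..d} \<subseteq> around_block u" using assms by (auto simp: around_block_def)
  then show "{d - r<..d} \<subseteq> high" unfolding high_def by blast
qed

lemma ten_power_ge: "2 \<le> u \<Longrightarrow> 50 * int u \<le> 10 ^ u"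
  by (induction u rule: dec_induct) auto

lemma ten_power_mult_le: "u < v \<Longrightarrow> 10 * 10 ^ u \<le> (10::'a::linordered_semidom) ^ v"
  using power_increasing[of "Suc u" v "10::'a"] by simp

lemma block_unique:
  assumes "n \<in> block u" "n \<in> block v"
  shows "u = v"
proof (rule ccontr)
  assume "u \<noteq> v"
  then have "10 * 10 ^ u \<le> (10::nat) ^ v \<or> 10 * 10 ^ v \<le> (10::nat) ^ u"
    by (auto simp: neq_iff intro: ten_power_mult_le)
  then show False using assms unfolding block_def by auto
qed

lemma int_block_bounds:
  assumes "n \<in> block u"
  shows "10 ^ u \<le> int n" "int n < 2 * 10 ^ u"
proof -
  have "int (10 ^ u) \<le> int n" "int n < int (2 * 10 ^ u)"
    using assms unfolding of_nat_le_iff of_nat_less_iff by (simp_all add: block_def)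
  then show "10 ^ u \<le> int n" "int n < 2 * 10 ^ u" by simp_all
qed

lemma sites_disjoint:
  assumes "n \<in> sites p" "n \<in> sites q"
  shows "p = q"
  using assms block_unique unfolding sites_def by auto

lemma elevation_ge_window:
  assumes "window sites k q m"
  obtains u where "2 * int q + int u \<le> int (elevation k)" "0 \<le> k" "k \<le> 3 * 10 ^ u"
proof -
  obtain u where u: "q + 2 \<le> u" "m \<in> block u" using assms by (auto simp: window_def sites_def)
  have near: "- int q \<le> k - int m" "k - int m \<le> int q" using assms by (auto simp: window_def)
  have size: "50 * int u \<le> 10 ^ u" "0 \<le> int q" "int q \<le> int u"
    using u(1) by (auto intro: ten_power_ge)
  have "10 ^ u + 2 * (2 * int q + int u) \<le> 2 * k + 2" "0 \<le> k" "k \<le> 3 * 10 ^ u"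
    using size near int_block_bounds[OF u(2)] unfolding distrib_left by linarith+
  then show thesis using that elevation_ge_around_block by blast
qed

lemma finite_low_windows:
  fixes B :: real
  shows "finite {k. \<exists>q m. window sites k q m \<and> 2 ^ elevation k \<le> B * 4 ^ q}"
proof -
  obtain U where U: "B < 2 ^ U" using real_arch_pow[of 2 B] by auto
  have "k \<in> {0..3 * 10 ^ U}"
    if window: "window sites k q m" and low: "2 ^ elevation k \<le> B * 4 ^ q" for k q m
  proof -
    obtain u where u: "2 * int q + int u \<le> int (elevation k)" "0 \<le> k" "k \<le> 3 * 10 ^ u"
      using elevation_ge_window[OF window] .
    have "2 ^ u * 4 ^ q = (2::real) ^ (2 * q + u)" by (simp add: power_add power_mult)
    also have "\<dots> \<le> 2 ^ elevation k" using u(1) by (intro power_increasing) auto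
    also note low
    finally have "2 ^ u * 4 ^ q \<le> B * 4 ^ q" .
    then have "(2::real) ^ u \<le> B" by simp
    then have "(2::real) ^ u < 2 ^ U" using U by linarith
    then have "u < U" by simp
    then have "(10::int) ^ u \<le> 10 ^ U" by (intro power_increasing) auto
    then have "k \<le> 3 * 10 ^ U" using u(3) by linarith
    then show ?thesis using u(2) by simp
  qed
  then have "{k. \<exists>q m. window sites k q m \<and> 2 ^ elevation k \<le> B * 4 ^ q} \<subseteq> {0..3 * 10 ^ U}"
    by blast
  then show ?thesis by (rule finite_subset) simp
qed

lemma elevation_gt_same_period:
  assumes "period p dvd n" "period p dvd m" "n \<noteq> m" "\<bar>k - int m\<bar> \<le> int p"
  shows "3 * p < elevation (k - int n)"
proof (cases "n < m")
  case True
  then obtain j where j: "m - n = period p * j" using assms(1,2) by (meson dvdE dvd_diff_nat)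
  then have "1 \<le> j" using True by (cases j) auto
  moreover have "int m - int n = int (period p * j)" using j True by (simp flip: of_nat_diff)
  ultimately have "3 * int p + 1 \<le> int (elevation (k - int n))"
    using assms(4) by (intro elevation_ge_near_multiple[of j]) auto
  then show ?thesis by simp
next
  case False
  then obtain j where j: "n - m = period p * j" using assms(1,2) by (meson dvdE dvd_diff_nat)
  then have "1 \<le> j" using False assms(3) by (cases j) auto
  then have "m + (200 * p + 40) \<le> n" using period_mult_ge[of j p] j False by simp
  then have "k - int n < - (3 * int p)" using assms(4) by linarith
  then show ?thesis unfolding elevation_def by linarith
qed

lemma elevation_gt_higher_block:
  assumes n: "n \<in> block v" and m: "m \<in> block u"
    and "v < u" "p < v" "q < u" "\<bar>k - int m\<bar> \<le> int q"
  shows "2 * q + p < elevation (k - int n)"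
proof -
  have "10 * 10 ^ v \<le> (10::int) ^ u" "50 * int u \<le> 10 ^ u" "int p \<le> int u" "0 \<le> int q" "int q \<le> int u"
    "- int q \<le> k - int m" "k - int m \<le> int q"
    using assms(3-) by (auto intro!: ten_power_mult_le ten_power_ge)
  then have "10 ^ u + 2 * (2 * int q + int p + 1) \<le> 2 * (k - int n) + 2" "k - int n \<le> 3 * 10 ^ u"
    using int_block_bounds[OF n] int_block_bounds[OF m]
    unfolding distrib_left right_diff_distrib by linarith+
  then have "2 * int q + int p + 1 \<le> int (elevation (k - int n))" by (rule elevation_ge_around_block)
  then show ?thesis by simp
qed

lemma elevation_gt_lower_block:
  assumes n: "n \<in> block v" and m: "m \<in> block u"
    and "u < v" "p < v" "q < u" "\<bar>k - int m\<bar> \<le> int q"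
  shows "2 * q + p < elevation (k - int n)"
proof -
  have "10 * 10 ^ u \<le> (10::int) ^ v" "50 * int v \<le> 10 ^ v"
    using assms(3,5) by (auto intro!: ten_power_mult_le ten_power_ge)
  then have "k - int n < - (2 * int q + int p)"
    using assms(3-) int_block_bounds[OF n] int_block_bounds[OF m] by linarith
  then show ?thesis unfolding elevation_def by linarith
qed

lemma elevation_windows_separated:
  assumes window: "window sites k q m" and n: "n \<in> sites p" and "n \<noteq> m"
  shows "2 * q + p < elevation (k - int n)"
proof -
  obtain u where u: "multiplicity 2 u = q" "q < u" "m \<in> block u" and m: "period q dvd m"
    using window by (auto simp: window_def sites_def)
  obtain v where v: "multiplicity 2 v = p" "p < v" "n \<in> block v" "period p dvd n"
    using n by (auto simp: sites_def)
  have near: "\<bar>k - int m\<bar> \<le> int q" using window by (simp add: window_def)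
  consider (same) "u = v" | (higher) "v < u" | (lower) "u < v" by linarith
  then show ?thesis
  proof cases
    case same
    then have "p = q" using u v by simp
    then show ?thesis using elevation_gt_same_period[of p n m k] v m \<open>n \<noteq> m\<close> near by simp
  next
    case higher
    then show ?thesis using u v near by (intro elevation_gt_higher_block)
  next
    case lower
    then show ?thesis using u v near by (intro elevation_gt_lower_block)
  qed
qed

section \<open>Density of the sites and of the points of weight one\<close>

lemma multiplicity_two_power_mult_odd:
  assumes "odd (a::nat)"
  shows "multiplicity 2 (2 ^ p * a) = p"
  using assms by (simp add: prime_elem_multiplicity_mult_distrib not_dvd_imp_multiplicity_0 odd_pos)

lemma card_sites_block_ge:
  assumes "p + 2 \<le> u" "multiplicity 2 u = p"
  shows "1 / (2 * real (period p)) * real (2 * 10 ^ u) \<le> real (card (sites p \<inter> {1..2 * 10 ^ u}))"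
proof -
  let ?K = "10 ^ (u - (p + 2)) :: nat" and ?f = "\<lambda>k. 10 ^ u + period p * k"
  have factor: "10 ^ u = period p * ?K"
    using assms(1) unfolding period_def by (metis le_add_diff_inverse power_add)
  have "?f ` {..<?K} \<subseteq> sites p \<inter> {1..2 * 10 ^ u}"
  proof
    fix n assume "n \<in> ?f ` {..<?K}"
    then obtain k where k: "k < ?K" "n = 10 ^ u + period p * k" by blast
    have "period p * k < 10 ^ u" using k(1) period_pos[of p] by (simp add: factor)
    then have "n \<in> block u" using k(2) by (simp add: block_def)
    moreover have "period p dvd n" using k(2) by (simp add: factor)
    moreover have "0 < n" using k(2) by simp
    ultimately show "n \<in> sites p \<inter> {1..2 * 10 ^ u}" using assms by (auto simp: sites_def block_def)
  qed
  then have "card (?f ` {..<?K}) \<le> card (sites p \<inter> {1..2 * 10 ^ u})" by (intro card_mono) auto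
  moreover have "card (?f ` {..<?K}) = ?K"
    using period_pos[of p] by (simp add: card_image inj_on_def)
  moreover have "1 / (2 * real (period p)) * real (2 * 10 ^ u) = real ?K"
    using period_pos[of p] unfolding factor by simp
  ultimately show ?thesis by (simp only: of_nat_le_iff)
qed

lemma lower_density_sites_pos: "0 < lower_density (sites p)"
proof (rule lower_density_pos_if_dense_at_geometric_scales)
  let ?u = "\<lambda>j. 2 ^ p * (2 * j + 3) :: nat"
  show "strict_mono (\<lambda>j. 2 * 10 ^ ?u j :: nat)" by (intro strict_monoI) simp
  show "2 * 10 ^ ?u (Suc j) \<le> 10 ^ (2 * 2 ^ p) * (2 * 10 ^ ?u j :: nat)" for j
    by (simp add: algebra_simps flip: power_add)
  have "p + 2 \<le> ?u j" for j
  proof -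
    have "p + 2 \<le> 3 * 2 ^ p" using less_exp[of p] by linarith
    also have "\<dots> \<le> ?u j" by simp
    finally show ?thesis .
  qed
  then show "1 / (2 * real (period p)) * real (2 * 10 ^ ?u j)
      \<le> real (card (sites p \<inter> {1..2 * 10 ^ ?u j}))" for j
    by (rule card_sites_block_ge) (rule multiplicity_two_power_mult_odd, simp)
qed (simp_all add: period_pos)

lemma card_near_multiples_le_div:
  "card {n \<in> {1..N}. int n \<in> near_multiples p} \<le> 2 * N div period p * (5 * p + 1)"
proof -
  let ?K = "2 * N div period p" and ?I = "\<lambda>k. {period p * k - 4 * p..period p * k + p}"
  have "{n \<in> {1..N}. int n \<in> near_multiples p} \<subseteq> (\<Union>k\<in>{1..?K}. ?I k)"
  proof
    fix n assume "n \<in> {n \<in> {1..N}. int n \<in> near_multiples p}"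
    then obtain k where k: "n \<le> N" "1 \<le> k"
      and near: "int (period p * k) \<le> int (n + 4 * p)" "int n \<le> int (period p * k + p)"
      by (auto simp: near_multiples_def)
    have "period p * k \<le> 2 * N"
      using k period_mult_ge[of k p] near(1) unfolding of_nat_le_iff by linarith
    then have "k \<le> ?K" by (simp add: less_eq_div_iff_mult_less_eq[OF period_pos] mult.commute)
    moreover have "n \<in> ?I k" using near unfolding of_nat_le_iff by simp
    ultimately show "n \<in> (\<Union>k\<in>{1..?K}. ?I k)" using k(2) by auto
  qed
  then have "card {n \<in> {1..N}. int n \<in> near_multiples p} \<le> card (\<Union>k\<in>{1..?K}. ?I k)"
    by (intro card_mono) auto
  also have "\<dots> \<le> (\<Sum>k\<in>{1..?K}. card (?I k))" by (rule card_UN_le) simp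
  also have "\<dots> \<le> (\<Sum>k\<in>{1..?K}. 5 * p + 1)" by (intro sum_mono) simp
  also have "\<dots> = ?K * (5 * p + 1)" by simp
  finally show ?thesis .
qed

lemma card_near_multiples_le:
  "real (card {n \<in> {1..N}. int n \<in> near_multiples p}) \<le> real N / 20 * (1 / 2) ^ p"
proof -
  have nonzero: "real (5 * p + 1) \<noteq> 0" by (simp only: of_nat_eq_0_iff)
  have "real (card {n \<in> {1..N}. int n \<in> near_multiples p}) \<le> real (2 * N div period p * (5 * p + 1))"
    by (rule of_nat_mono[OF card_near_multiples_le_div])
  also have "\<dots> \<le> real (2 * N) / real (period p) * real (5 * p + 1)"
    unfolding of_nat_mult[of "2 * N div period p"] by (rule mult_right_mono[OF of_nat_div_le_of_nat]) simp
  also have "\<dots> \<le> real (2 * N) / real (40 * 2 ^ p * (5 * p + 1)) * real (5 * p + 1)"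
    by (intro mult_right_mono frac_le of_nat_mono period_ge) (simp_all del: of_nat_mult of_nat_add)
  also have "\<dots> = real N / 20 * (1 / 2) ^ p"
    using nonzero unfolding of_nat_mult[of _ "5 * p + 1"] by (simp add: power_divide)
  finally show ?thesis .
qed

lemma notin_high_between_blocks:
  assumes "3 * 10 ^ u < d" "d < 5 * 10 ^ u" "\<And>p. int p < d \<Longrightarrow> d \<notin> near_multiples p"
  shows "d \<notin> high"
proof -
  have "d \<notin> around_block v" for v
  proof (cases "v \<le> u")
    case True
    then have "(10::int) ^ v \<le> 10 ^ u" by (intro power_increasing) auto
    then have "3 * 10 ^ v < d" using assms(1) by linarith
    then show ?thesis by (simp add: around_block_def)
  next
    case False
    then have "10 * 10 ^ u \<le> (10::int) ^ v" by (intro ten_power_mult_le) simp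
    then have "2 * d < 10 ^ v" using assms(2) by linarith
    then show ?thesis by (simp add: around_block_def)
  qed
  then show ?thesis using assms(3) near_multiples_gt by (auto simp: high_def)
qed

lemma card_elevation_0_ge:
  assumes "1 \<le> u"
  shows "10 ^ u \<le> card ({n. elevation (int n) = 0} \<inter> {1..5 * 10 ^ u})"
proof -
  let ?N = "5 * 10 ^ u :: nat"
  let ?Z = "{n. elevation (int n) = 0} \<inter> {1..?N}" and ?G = "{3 * 10 ^ u<..<5 * 10 ^ u :: nat}"
  define near where "near p = {n \<in> {1..?N}. int n \<in> near_multiples p}" for p
  let ?U = "\<Union>p<?N. near p"
  have "?G - ?U \<subseteq> ?Z"
  proof
    fix n assume n: "n \<in> ?G - ?U"
    then have "int (3 * 10 ^ u) < int n" "int n < int (5 * 10 ^ u)" unfolding of_nat_less_iff by auto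
    then have bounds: "3 * 10 ^ u < int n" "int n < 5 * 10 ^ u" by simp_all
    have "int n \<notin> near_multiples p" if "int p < int n" for p
      using n that by (auto simp: near_def)
    then have "int n \<notin> high" by (rule notin_high_between_blocks[OF bounds])
    then show "n \<in> ?Z" using n by (auto intro: elevation_eq_0)
  qed
  then have "card (?G - ?U) \<le> card ?Z" by (intro card_mono) auto
  moreover have "card ?G - card ?U \<le> card (?G - ?U)"
    by (rule diff_card_le_card_Diff) (auto simp: near_def)
  ultimately have "card ?G \<le> card ?U + card ?Z" by linarith
  then have "2 * 10 ^ u - 1 \<le> card ?U + card ?Z" by simp
  moreover have "2 * card ?U \<le> 10 ^ u"
  proof -
    have "real (card ?U) \<le> real (\<Sum>p<?N. card (near p))"
      by (simp only: of_nat_le_iff) (rule card_UN_le, simp)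
    also have "\<dots> \<le> (\<Sum>p<?N. real ?N / 20 * (1 / 2) ^ p)"
      unfolding of_nat_sum near_def by (intro sum_mono card_near_multiples_le)
    also have "\<dots> = real ?N / 20 * (\<Sum>p<?N. (1 / 2) ^ p)" by (simp add: sum_distrib_left)
    also have "\<dots> \<le> real ?N / 20 * 2" by (intro mult_left_mono) (auto simp: sum_gp_strict)
    finally have "real (2 * card ?U) \<le> real (10 ^ u)" by simp
    then show ?thesis by (simp only: of_nat_le_iff)
  qed
  moreover have "10 \<le> (10::nat) ^ u" using power_increasing[OF assms, of "10::nat"] by simp
  ultimately show ?thesis by linarith
qed

lemma upper_density_elevation_0_pos: "0 < upper_density {n. elevation (int n) = 0}"
proof -
  have "ereal (1 / 5) \<le> upper_density {n. elevation (int n) = 0}"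
  proof (rule upper_density_ge_if_dense_at_scales)
    show "strict_mono (\<lambda>j. 5 * 10 ^ Suc j :: nat)" by (intro strict_monoI) simp
    show "1 / 5 * real (5 * 10 ^ Suc j)
        \<le> real (card ({n. elevation (int n) = 0} \<inter> {1..5 * 10 ^ Suc j}))" for j
      using of_nat_mono[OF card_elevation_0_ge[of "Suc j"], where ?'a = real] by simp
  qed simp
  moreover have "0 < ereal (1 / 5)" by simp
  ultimately show ?thesis by (rule less_le_trans[rotated])
qed

section \<open>The operator\<close>

interpretation elevated: c0_weighted_shift_with_sites "\<lambda>d. 2 ^ elevation d" 2 sites
proof
  show "(2::real) ^ elevation (j + 1) \<le> 2 * 2 ^ elevation j" for j
    using power_increasing[OF elevation_step[of j], of "2::real"] by simp
  show "(2::real) ^ elevation i \<le> 2 ^ nat \<bar>i\<bar>" for i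
    by (intro power_increasing elevation_le_abs) simp
  show "4 ^ q * 2 ^ p < (2::real) ^ elevation (k - int n)"
    if "window sites k q m" "n \<in> sites p" "n \<noteq> m" for k q m n p
  proof -
    have "(2::real) ^ (2 * q + p) < 2 ^ elevation (k - int n)"
      using elevation_windows_separated[OF that] by (rule power_strict_increasing) simp
    then show ?thesis by (simp add: power_add power_mult)
  qed
  show "p = q" if "n \<in> sites p" "n \<in> sites q" for n p q
    using that by (rule sites_disjoint)
  show "0 < lower_density (sites p)" for p by (rule lower_density_sites_pos)
  show "finite {k. \<exists>q m. window sites k q m \<and> 2 ^ elevation k \<le> B * 4 ^ q}" for B :: real
    by (rule finite_low_windows)
qed simp

theorem theorem1p3:
  shows "\<exists>T :: c0 \<Rightarrow> c0. bounded_linear T \<and> freq_hypercyclic T \<and>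
           \<not> (\<exists>m. borel_prob_measure m \<and> invariant_measure T m \<and>
                  ergodic_measure T m \<and> full_support m)"
proof (intro exI conjI)
  show "bounded_linear elevated.shift" by (rule elevated.bounded_linear_shift)
  show "freq_hypercyclic elevated.shift" by (rule elevated.freq_hypercyclic_shift)
  have "elevation d = 0 \<longleftrightarrow> (2::real) ^ elevation d \<le> 1" for d by (simp add: power_le_one_iff)
  then have "0 < upper_density {n. (2::real) ^ elevation (int n) \<le> 1}"
    using upper_density_elevation_0_pos by simp
  then show "\<not> (\<exists>m. borel_prob_measure m \<and> invariant_measure elevated.shift m \<and>
      ergodic_measure elevated.shift m \<and> full_support m)"
    using elevated.shift_no_ergodic_full_support by blast
qed

end
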